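(* For every $n\ge 7$, the difference graph $\mathcal{D}(A_n)$ of the alternating group $A_n$ on $n$ letters is not a chordal graph.
   Context: Difference graph: for a finite group $G$, the power graph $\mathcal{P}(G)$ is the simple undirected graph with vertex set $G$ in which distinct $a,b$ are adjacent iff $a\in\langle b\rangle$ or $b\in\langle a\rangle$. The enhanced power graph $\mathcal{P}_E(G)$ is the simple undirected graph with vertex set $G$ in which distinct $a,b$ are adjacent iff $a,b\in\langle c\rangle$ for some $c\in G$. The difference graph $\mathcal{D}(G)$ is obtained from the graph $\mathcal{P}_E(G)-\mathcal{P}(G)$ (vertex set $G$; two vertices are adjacent iff they are adjacent in $\mathcal{P}_E(G)$ but not in $\mathcal{P}(G)$) by removing all isolated vertices. A graph is chordal if it has no induced subgraph isomorphic to a cycle $C_m$ with $m\ge4$. *)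

theory Defs
  imports "HOL-Algebra.Sym_Groups" "Graph_Theory.Graph_Theory"
begin

text \<open>
  A simple undirected graph is represented as a \<open>pair_pre_digraph\<close> whose arc relation is symmetric
  and irreflexive: an edge between \<open>u\<close> and \<open>v\<close> is the pair of arcs \<open>(u, v)\<close> and \<open>(v, u)\<close>
  (locale \<open>pair_bidirected_digraph\<close>, and \<open>pair_graph\<close> for finite graphs).
\<close>

definition power_graph :: "('a, 'b) monoid_scheme \<Rightarrow> 'a pair_pre_digraph" where
  "power_graph G = \<lparr> pverts = carrier G,
     parcs = {(a, b). a \<in> carrier G \<and> b \<in> carrier G \<and> a \<noteq> b \<and>
                (a \<in> generate G {b} \<or> b \<in> generate G {a})} \<rparr>"

definition enhanced_power_graph :: "('a, 'b) monoid_scheme \<Rightarrow> 'a pair_pre_digraph" where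
  "enhanced_power_graph G = \<lparr> pverts = carrier G,
     parcs = {(a, b). a \<in> carrier G \<and> b \<in> carrier G \<and> a \<noteq> b \<and>
                (\<exists>c \<in> carrier G. a \<in> generate G {c} \<and> b \<in> generate G {c})} \<rparr>"

definition graph_minus_edges :: "'a pair_pre_digraph \<Rightarrow> 'a pair_pre_digraph \<Rightarrow> 'a pair_pre_digraph" where
  "graph_minus_edges \<Gamma> \<Delta> = \<lparr> pverts = pverts \<Gamma>, parcs = parcs \<Gamma> - parcs \<Delta> \<rparr>"

definition isolated_verts :: "'a pair_pre_digraph \<Rightarrow> 'a set" where
  "isolated_verts \<Gamma> = {v \<in> pverts \<Gamma>. \<forall>u. (u, v) \<notin> parcs \<Gamma> \<and> (v, u) \<notin> parcs \<Gamma>}"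

text \<open>Deleting isolated vertices deletes no arcs.\<close>

definition remove_isolated :: "'a pair_pre_digraph \<Rightarrow> 'a pair_pre_digraph" where
  "remove_isolated \<Gamma> = \<lparr> pverts = pverts \<Gamma> - isolated_verts \<Gamma>, parcs = parcs \<Gamma> \<rparr>"

definition difference_graph :: "('a, 'b) monoid_scheme \<Rightarrow> 'a pair_pre_digraph" where
  "difference_graph G =
     remove_isolated (graph_minus_edges (enhanced_power_graph G) (power_graph G))"

text \<open>The cycle \<open>C\<^sub>m\<close>; this is a simple graph with \<open>m\<close> edges only for \<open>m \<ge> 3\<close>.\<close>

definition cycle_graph :: "nat \<Rightarrow> nat pair_pre_digraph" where
  "cycle_graph m = \<lparr> pverts = {0..<m},
     parcs = {(i, j). i < m \<and> j < m \<and> (j = Suc i mod m \<or> i = Suc j mod m)} \<rparr>"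

text \<open>
  For graphs in the symmetric-arc representation, an isomorphism of digraphs is the same as an
  isomorphism of undirected graphs.
\<close>

definition chordal :: "'a pair_pre_digraph \<Rightarrow> bool" where
  "chordal \<Gamma> \<longleftrightarrow>
     \<not> (\<exists>m \<ge> 4. \<exists>H :: 'a pair_pre_digraph. induced_subgraph (with_proj H) (with_proj \<Gamma>) \<and>
          digraph_iso (with_proj H) (with_proj (cycle_graph m)))"

text \<open>The graphs above are simple graphs in the sense of the library.\<close>

lemma pair_graph_cycle_graph:
  assumes "m \<ge> 3"
  shows "pair_graph (cycle_graph m)"
proof -
  have "parcs (cycle_graph m) \<subseteq> {0..<m} \<times> {0..<m}"
    by (auto simp: cycle_graph_def)
  then have "finite (parcs (cycle_graph m))"
    by (rule finite_subset) simp
  moreover have "Suc i mod m \<noteq> i" if "i < m" for i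
    using that assms by (simp add: mod_Suc)
  ultimately show ?thesis
    by unfold_locales
      (auto simp: cycle_graph_def symmetric_def intro!: symI; metis)+
qed

lemma pair_graph_difference_graph:
  assumes "finite (carrier G)"
  shows "pair_graph (difference_graph G)"
proof -
  have "parcs (difference_graph G) \<subseteq> carrier G \<times> carrier G"
    by (auto simp: difference_graph_def remove_isolated_def graph_minus_edges_def
          enhanced_power_graph_def)
  then have "finite (parcs (difference_graph G))"
    by (rule finite_subset) (simp add: assms)
  then show ?thesis
    using assms
    by unfold_locales
      (auto simp: difference_graph_def remove_isolated_def isolated_verts_def
         graph_minus_edges_def enhanced_power_graph_def power_graph_def symmetric_def
         intro!: symI)
qed

end

theory Submission
  imports Defs "HOL-Algebra.Multiplicative_Group"
begin

text \<open>
  A 3-cycle \<open>a\<close> and an involution \<open>x\<close> that commute are powers of \<open>a x\<close>, so they are adjacent in the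
  difference graph. A cyclic group contains at most one involution, so distinct involutions are
  never adjacent, and neither are \<open>a\<close> and \<open>a\<inverse>\<close>, which generate the same subgroup. Hence a 3-cycle
  and two distinct involutions \<open>x\<close>, \<open>y\<close> commuting with it yield the induced 4-cycle
  \<open>a, x, a\<inverse>, y\<close>. On seven letters take \<open>a = (1 2 3)\<close>, \<open>x = (4 5)(6 7)\<close> and \<open>y = (4 6)(5 7)\<close>.
\<close>

lemma not_chordal_if_induced_square:
  assumes wf: "pair_wf_digraph \<Gamma>"
    and dist: "distinct [p, q, r, s]"
    and verts: "{p, q, r, s} \<subseteq> pverts \<Gamma>"
    and arcs: "parcs \<Gamma> \<inter> ({p, q, r, s} \<times> {p, q, r, s}) =
      {(p, q), (q, p), (q, r), (r, q), (r, s), (s, r), (s, p), (p, s)}"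
  shows "\<not> chordal \<Gamma>"
proof -
  define H where "H = \<lparr> pverts = {p, q, r, s},
    parcs = {(p, q), (q, p), (q, r), (r, q), (r, s), (s, r), (s, p), (p, s)} \<rparr>"
  \<comment> \<open>\<open>f\<close> numbers the vertices in cyclic order around the square, the
    last branch being for \<open>s\<close>, so that edges go to pairs of consecutive residues mod
    4.\<close>
  define f :: "'a \<Rightarrow> nat" where
    "f v = (if v = p then 0 else if v = q then 1 else if v = r then 2 else 3)" for v
  define h where "h = \<lparr> iso_verts = f, iso_arcs = map_prod f f, iso_head = snd, iso_tail = fst \<rparr>"
  have wfH: "wf_digraph (with_proj H)"
    by unfold_locales (auto simp: H_def)
  have sub: "pverts H \<subseteq> pverts \<Gamma>" "parcs H = parcs \<Gamma> \<inter> (pverts H \<times> pverts H)"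
    unfolding H_def pair_pre_digraph.simps arcs using verts by blast+
  have "subgraph (with_proj H) (with_proj \<Gamma>)"
    using sub wfH wf by (simp add: subgraph_def wf_digraph_wp_iff compatibleI_with_proj)
  then have ind: "induced_subgraph (with_proj H) (with_proj \<Gamma>)"
    using sub by (auto simp: induced_subgraph_def)
  have f: "f p = 0" "f q = 1" "f r = 2" "f s = 3"
    using dist by (auto simp: f_def)
  have inj: "inj_on f (pverts H)"
    by (auto simp: H_def inj_on_def f)
  have "inj_on (map_prod f f) (parcs H)"
    using map_prod_inj_on[OF inj inj] by (rule inj_on_subset) (auto simp: H_def)
  then have "pre_digraph.digraph_isomorphism (with_proj H) h"
    using inj wfH by (auto simp: pre_digraph.digraph_isomorphism_def h_def)
  moreover have "with_proj (cycle_graph 4) = app_iso h (with_proj H)"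
  proof -
    \<comment> \<open>Spelling out the four cases turns the arc set of the cycle into an explicit
      finite set, in which \<open>Suc i mod 4\<close> can be evaluated.\<close>
    have lt4: "i < 4 \<longleftrightarrow> i = 0 \<or> i = 1 \<or> i = 2 \<or> i = 3" for i :: nat
      by auto
    have "pverts (cycle_graph 4) = f ` pverts H"
      by (auto simp: cycle_graph_def H_def f)
    moreover have "parcs (cycle_graph 4) = map_prod f f ` parcs H"
      by (auto simp: cycle_graph_def H_def f lt4)
    ultimately show ?thesis
      by (simp add: app_iso_def h_def with_proj_def)
  qed
  ultimately have "digraph_iso (with_proj H) (with_proj (cycle_graph 4))"
    unfolding digraph_iso_def by blast
  with ind show ?thesis
    unfolding chordal_def by (metis order_refl)
qed

lemma pair_wf_digraph_difference_graph: "pair_wf_digraph (difference_graph G)"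
  by unfold_locales
    (auto simp: difference_graph_def remove_isolated_def isolated_verts_def graph_minus_edges_def
       enhanced_power_graph_def power_graph_def)

text \<open>Distinctness of \<open>a\<close> and \<open>b\<close> can be left out: each element lies
  in the subgroup it generates, so the last two conditions already exclude
  \<open>a = b\<close>.\<close>

lemma parcs_difference_graph:
  "(a, b) \<in> parcs (difference_graph G) \<longleftrightarrow> a \<in> carrier G \<and> b \<in> carrier G \<and>
     (\<exists>c \<in> carrier G. a \<in> generate G {c} \<and> b \<in> generate G {c}) \<and>
     a \<notin> generate G {b} \<and> b \<notin> generate G {a}"
  by (auto simp: difference_graph_def remove_isolated_def graph_minus_edges_def
      enhanced_power_graph_def power_graph_def intro: generate.incl)

context group
begin

text \<open>Every power of \<open>c\<close> inherits the exponent \<open>n\<close>. Together with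
  \<open>coprime_pow_eq_one\<close> this keeps a nontrivial element of coprime exponent out of the
  subgroup generated by \<open>c\<close>.\<close>

lemma generate_singleton_pow_eq_one:
  assumes "c \<in> carrier G" "b \<in> generate G {c}" "c [^] (n :: nat) = \<one>"
  shows "b [^] n = \<one>"
proof -
  obtain k :: int where "b = c [^] k"
    using assms generate_pow by auto
  then have "b [^] n = (c [^] n) [^] k"
    using assms(1) by (simp add: int_pow_pow mult.commute flip: int_pow_int)
  then show ?thesis
    using assms(3) by simp
qed

lemma coprime_pow_eq_one:
  assumes a: "a \<in> carrier G" and "coprime m n" "a [^] (m :: nat) = \<one>" "a [^] (n :: nat) = \<one>"
  shows "a = \<one>"
  using assms by (metis coprime_common_divisor_nat ord_eq_1 pow_eq_id)

text \<open>By Bezout some multiple of \<open>n\<close> is 1 modulo \<open>m\<close>; raising the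
  product to that power kills \<open>x\<close> and leaves \<open>a\<close>.\<close>

lemma left_factor_in_generate_mult:
  assumes a: "a \<in> carrier G" and x: "x \<in> carrier G" and comm: "a \<otimes> x = x \<otimes> a"
    and "coprime m n" and am: "a [^] (m :: nat) = \<one>" and xn: "x [^] (n :: nat) = \<one>"
  shows "a \<in> generate G {a \<otimes> x}"
proof -
  have "coprime (int m) (int n)"
    using assms by simp
  then obtain u v where uv: "u * int m + v * int n = 1"
    by (metis bezout_int coprime_imp_gcd_eq_1)
  have am': "a [^] (int m * u) = \<one>" and xn': "x [^] (int n * v) = \<one>"
    using a x am xn by (simp_all add: int_pow_int flip: int_pow_pow)
  have "(a \<otimes> x) [^] (int n * v) = a [^] (int n * v)"
    using a x comm xn' by (simp add: int_pow_mult_distrib)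
  also have "\<dots> = a [^] (int m * u + int n * v)"
    using a am' by (simp add: int_pow_mult)
  also have "\<dots> = a"
    using uv a by (simp add: mult.commute)
  finally show ?thesis
    using a x generate_pow[of "a \<otimes> x"] by (metis (mono_tags, lifting) UNIV_I m_closed mem_Collect_eq)
qed

lemma difference_graph_adjI:
  assumes a: "a \<in> carrier G" and x: "x \<in> carrier G" and comm: "a \<otimes> x = x \<otimes> a"
    and cop: "coprime m n" and am: "a [^] (m :: nat) = \<one>" and xn: "x [^] (n :: nat) = \<one>"
    and "a \<noteq> \<one>" "x \<noteq> \<one>"
  shows "(a, x) \<in> parcs (difference_graph G)" "(x, a) \<in> parcs (difference_graph G)"
proof -
  have "a \<in> generate G {a \<otimes> x}"
    using left_factor_in_generate_mult[OF a x comm cop am xn] .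
  \<comment> \<open>The same lemma with the factors exchanged puts \<open>x\<close> into the
    subgroup generated by \<open>x \<otimes> a\<close>, which equals
    \<open>a \<otimes> x\<close>.\<close>
  moreover have "x \<in> generate G {a \<otimes> x}"
    using left_factor_in_generate_mult[OF x a comm[symmetric] _ xn am] cop comm
    by (simp add: coprime_commute)
  moreover have "a \<notin> generate G {x}"
    using generate_singleton_pow_eq_one[OF x _ xn] coprime_pow_eq_one[OF a cop am] \<open>a \<noteq> \<one>\<close> by blast
  moreover have "x \<notin> generate G {a}"
    using generate_singleton_pow_eq_one[OF a _ am] coprime_pow_eq_one[OF x cop _ xn] \<open>x \<noteq> \<one>\<close>
    by blast
  ultimately show "(a, x) \<in> parcs (difference_graph G)" "(x, a) \<in> parcs (difference_graph G)"
    using a x by (auto simp: parcs_difference_graph)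
qed

lemma inv_commute:
  assumes "a \<otimes> x = x \<otimes> a" "a \<in> carrier G" "x \<in> carrier G"
  shows "inv a \<otimes> x = x \<otimes> inv a"
proof -
  have "inv a \<otimes> x = inv a \<otimes> (x \<otimes> a) \<otimes> inv a"
    using assms by (simp add: m_assoc)
  also have "\<dots> = x \<otimes> inv a"
    using assms by (simp flip: assms(1)) (simp flip: m_assoc)
  finally show ?thesis .
qed

text \<open>The exponent of an involution is an odd multiple of half the order of \<open>c\<close>,
  so two such exponents differ by a multiple of the order. Working with divisibility by
  \<open>ord c\<close> also covers infinite order, where \<open>ord c = 0\<close>.\<close>

lemma involution_unique_in_generate:
  assumes c: "c \<in> carrier G" and x: "x \<in> generate G {c}" and y: "y \<in> generate G {c}"
    and "x \<noteq> \<one>" "y \<noteq> \<one>" "x \<otimes> x = \<one>" "y \<otimes> y = \<one>"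
  shows "x = y"
proof -
  obtain i j :: int where ij: "x = c [^] i" "y = c [^] j"
    using c x y generate_pow by auto
  let ?d = "int (ord c)"
  have "?d dvd i + i" "?d dvd j + j" "\<not> ?d dvd i" "\<not> ?d dvd j"
    using assms unfolding ij int_pow_eq_id[OF c, symmetric] by (simp_all only: int_pow_mult[OF c] simp_thms)
  then obtain k l where kl: "i + i = ?d * k" "j + j = ?d * l"
    by (auto simp: dvd_def)
  \<comment> \<open>If \<open>k\<close> were even, cancelling 2 would make \<open>?d\<close> divide
    \<open>i\<close>, that is \<open>x = \<one>\<close>.\<close>
  have "odd k"
    using kl(1) \<open>\<not> ?d dvd i\<close> by (auto elim!: evenE)
  moreover have "odd l"
    using kl(2) \<open>\<not> ?d dvd j\<close> by (auto elim!: evenE)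
  ultimately obtain e where "k - l = 2 * e"
    by (meson evenE odd_even_add even_diff)
  moreover have "2 * (i - j) = ?d * (k - l)"
    unfolding right_diff_distrib using kl by linarith
  ultimately have "i - j = ?d * e"
    by simp
  then have "?d dvd i - j"
    by simp
  then show ?thesis
    using c ij int_pow_eq[of c] by (simp add: dvd_diff_commute)
qed

text \<open>The orders 3 and 2 are expressed by products instead of powers, so that for permutations
  they become plain equations between compositions.\<close>

theorem not_chordal_difference_graph:
  assumes a: "a \<in> carrier G" "a \<noteq> \<one>" "a \<otimes> a \<otimes> a = \<one>"
    and x: "x \<in> carrier G" "x \<noteq> \<one>" "x \<otimes> x = \<one>"
    and y: "y \<in> carrier G" "y \<noteq> \<one>" "y \<otimes> y = \<one>"
    and "x \<noteq> y" and ax: "a \<otimes> x = x \<otimes> a" and ay: "a \<otimes> y = y \<otimes> a"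
  shows "\<not> chordal (difference_graph G)"
proof -
  let ?E = "parcs (difference_graph G)"
  define b where "b = inv a"
  have b: "b \<in> carrier G" "b \<noteq> \<one>"
    using a by (auto simp: b_def)
  have a3: "a [^] (3 :: nat) = \<one>"
    using a by (simp add: numeral_3_eq_3)
  then have b3: "b [^] (3 :: nat) = \<one>"
    using a by (simp add: b_def nat_pow_inv)
  have x2: "x [^] (2 :: nat) = \<one>" and y2: "y [^] (2 :: nat) = \<one>"
    using x y by (simp_all add: numeral_2_eq_2)
  have xb: "b \<otimes> x = x \<otimes> b" and yb: "b \<otimes> y = y \<otimes> b"
    using inv_commute[OF ax] inv_commute[OF ay] a x y by (simp_all add: b_def)
  have cop: "coprime (3 :: nat) 2"
    by simp
  note adj = difference_graph_adjI[OF a(1) x(1) ax cop a3 x2 a(2) x(2)]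
    difference_graph_adjI[OF a(1) y(1) ay cop a3 y2 a(2) y(2)]
    difference_graph_adjI[OF b(1) x(1) xb cop b3 x2 b(2) x(2)]
    difference_graph_adjI[OF b(1) y(1) yb cop b3 y2 b(2) y(2)]
  have noloop: "(v, v) \<notin> ?E" for v
    by (auto simp: parcs_difference_graph intro: generate.incl)
  have "a \<in> generate G {b}" "b \<in> generate G {a}"
    using a generate.inv[of b "{b}" G] generate.inv[of a "{a}" G] by (auto simp: b_def)
  then have ab: "(a, b) \<notin> ?E" "(b, a) \<notin> ?E"
    by (auto simp: parcs_difference_graph)
  have xy: "(x, y) \<notin> ?E" "(y, x) \<notin> ?E"
    using x y \<open>x \<noteq> y\<close> involution_unique_in_generate by (auto simp: parcs_difference_graph)
  have "a \<noteq> b"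
  proof
    assume "a = b"
    then have "a \<otimes> a = \<one>"
      using a by (metis b_def r_inv)
    then show False
      using a by simp
  qed
  \<comment> \<open>Neighbours differ because there are no loops; only the two diagonals
    \<open>a\<close>, \<open>b\<close> and \<open>x\<close>, \<open>y\<close> need their own
    inequalities.\<close>
  then have "distinct [a, x, b, y]"
    using adj noloop \<open>x \<noteq> y\<close> by auto
  moreover have "{a, x, b, y} \<subseteq> pverts (difference_graph G)"
    using adj pair_wf_digraph.arc_fst_in_verts[OF pair_wf_digraph_difference_graph]
    by fastforce
  moreover have "?E \<inter> ({a, x, b, y} \<times> {a, x, b, y}) =
      {(a, x), (x, a), (x, b), (b, x), (b, y), (y, b), (y, a), (a, y)}"
    using adj noloop ab xy by auto
  ultimately show ?thesis
    by (rule not_chordal_if_induced_square[OF pair_wf_digraph_difference_graph])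
qed

end

text \<open>The two transpositions may overlap, so this covers 3-cycles as well as double
  transpositions.\<close>

lemma transpose_comp_in_alt_group:
  assumes "a \<noteq> b" "c \<noteq> d" "{a, b, c, d} \<subseteq> {1..n}"
  shows "transpose a b \<circ> transpose c d \<in> carrier (alt_group n)"
  unfolding alt_group_carrier
  using assms
  by (auto intro!: permutes_compose permutes_swap_id
      simp: evenperm_comp permutation_swap_id evenperm_swap)

theorem theorem5p4:
  fixes n :: nat
  assumes "n \<ge> 7"
  shows "\<not> chordal (difference_graph (alt_group n))"
proof -
  \<comment> \<open>The overlapping transpositions compose to the 3-cycle 1 to 2 to 3 to 1. Both
    involutions move only 4, 5, 6, 7, which makes them commute with \<open>a\<close>.\<close>
  define a x y :: "nat \<Rightarrow> nat" where
    "a = transpose 1 2 \<circ> transpose 2 3" and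
    "x = transpose 4 5 \<circ> transpose 6 7" and
    "y = transpose 4 6 \<circ> transpose 5 7"
  note defs = a_def x_def y_def
  have "a \<in> carrier (alt_group n)" "x \<in> carrier (alt_group n)" "y \<in> carrier (alt_group n)"
    unfolding defs using assms by (auto intro!: transpose_comp_in_alt_group)
  \<comment> \<open>One point separates each pair of permutations: \<open>a\<close> sends 1 to 2,
    while \<open>x\<close> and \<open>y\<close> send 4 to 5 and 6.\<close>
  moreover have "a 1 \<noteq> 1" "x 4 \<noteq> 4" "y 4 \<noteq> 4" "x 4 \<noteq> y 4"
    by (simp_all add: defs transpose_def)
  then have "a \<noteq> id" "x \<noteq> id" "y \<noteq> id" "x \<noteq> y"
    by auto
  moreover have "a \<circ> a \<circ> a = id" "x \<circ> x = id" "y \<circ> y = id" "a \<circ> x = x \<circ> a" "a \<circ> y = y \<circ> a"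
    by (simp_all add: defs fun_eq_iff transpose_def)
  ultimately show ?thesis
    using group.not_chordal_difference_graph[OF alt_group_is_group, of a n x y]
    by (simp add: alt_group_mult alt_group_one)
qed

end
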